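(* Let $q$ be a prime power of the form $q=6m+5$ with $m$ an integer and $q>11$. Then there are no permutation polynomials of $\mathbb{F}_q$ of degree $6$.
   Context: A polynomial $f\in\mathbb{F}_q[x]$ is a permutation polynomial of the finite field $\mathbb{F}_q$ if the function $c\mapsto f(c)$ is a permutation of $\mathbb{F}_q$. *)

theory Defs
  imports
    "HOL-Computational_Algebra.Polynomial"
    "HOL-Library.Cardinality"
    "HOL-Number_Theory.Prime_Powers"
begin

definition permutation_poly :: "'a::{field,finite} poly \<Rightarrow> bool"
  where "permutation_poly f \<longleftrightarrow> bij (poly f)"

end

theory Submission
  imports Defs
begin

text \<open>
  Translating and scaling, a sextic may be taken as \<open>F = x^6 + a x^4 + b x^3 + c x^2 + d x\<close>, since
  the characteristic divides neither 2 nor 3. If \<open>F\<close> permutes the field, then \<open>\<Sum>\<^sub>x F(x)^k = 0\<close> for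
  \<open>k < q - 1\<close> (Hermite), so for small \<open>D\<close> and \<open>6 k = q - 1 + D\<close> the coefficient of \<open>x^(q - 1)\<close> in
  \<open>F^k\<close> vanishes. As \<open>6 k = D - 1\<close> in the field, \<open>D = 2, 8, 14\<close> give \<open>a = 0\<close>, \<open>c^2 + 2bd = 0\<close> and
  \<open>d (5b^3 + 9cd) = 0\<close>. If \<open>d = 0\<close> then \<open>F\<close> is a quadratic in \<open>x^3\<close> and is not injective. Otherwise
  \<open>D = 20\<close> is contradictory if \<open>b = 0\<close>, and gives \<open>313 b^5 = 0\<close> if not. The integers that must
  not vanish are products of primes that are not 5 modulo 6, whereas the characteristic is; in
  characteristic 5 the relations already force \<open>b = c = 0\<close> when \<open>d\<close> is nonzero. For
  \<open>q = 17\<close> the last power sum also involves the coefficient of \<open>x^(2 (q - 1))\<close>.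
\<close>

section \<open>Power sums over a finite field\<close>

lemma finite_field_power_card_minus_1:
  fixes x :: "'a::{field,finite}"
  assumes "x \<noteq> 0"
  shows "x ^ (CARD('a) - 1) = 1"
proof -
  let ?U = "UNIV - {0 :: 'a}"
  have "bij_betw ((*) x) ?U ?U"
    using assms by (intro bij_betwI[where g = "\<lambda>y. y / x"]) auto
  then have "(\<Prod>y\<in>?U. x * y) = \<Prod>?U"
    by (rule prod.reindex_bij_betw)
  moreover have "(\<Prod>y\<in>?U. x * y) = x ^ (CARD('a) - 1) * \<Prod>?U"
    by (simp add: prod.distrib card_Diff_subset)
  moreover have "\<Prod>?U \<noteq> 0"
    by simp
  ultimately show ?thesis
    by (metis mult_cancel_right1)
qed

lemma of_nat_CARD_eq_0: "of_nat CARD('a) = (0 :: 'a::{field,finite})"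
proof -
  have "bij (\<lambda>x :: 'a. x + 1)"
    by (intro bij_betwI[where g = "\<lambda>y. y - 1"]) auto
  then have "(\<Sum>x\<in>UNIV. x + 1) = (\<Sum>x\<in>UNIV. x :: 'a)"
    by (rule sum.reindex_bij_betw)
  then show ?thesis
    by (simp add: sum.distrib)
qed

text \<open>Since \<open>x^j - 1\<close> has at most \<open>j\<close> roots, some nonzero
  \<open>g\<close> has \<open>g^j \<noteq> 1\<close>; substituting \<open>g * x\<close> for
  \<open>x\<close> multiplies the sum by \<open>g^j\<close>.\<close>

lemma sum_power_finite_field_eq_0:
  assumes "j < CARD('a) - 1"
  shows "(\<Sum>x\<in>UNIV. x ^ j) = (0 :: 'a::{field,finite})"
proof (cases "j = 0")
  case True
  then show ?thesis by (simp add: of_nat_CARD_eq_0)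
next
  case False
  let ?p = "monom 1 j - 1 :: 'a poly"
  have "coeff ?p j = 1"
    using False by simp
  then have nz: "?p \<noteq> 0"
    by (metis coeff_0 zero_neq_one)
  have "degree ?p \<le> j"
    by (intro degree_diff_le) (auto simp: degree_monom_le)
  then have "card {x. poly ?p x = 0} \<le> j"
    using card_poly_roots_bound[OF nz] by linarith
  also have "j < card (UNIV - {0 :: 'a})"
    using assms by (simp add: card_Diff_subset)
  finally have "\<not> UNIV - {0} \<subseteq> {x. poly ?p x = 0}"
    by (meson card_mono finite leD)
  then obtain g :: 'a where "g \<noteq> 0" "poly ?p g \<noteq> 0"
    by blast
  then have g: "g \<noteq> 0" "g ^ j \<noteq> 1"
    by (simp_all add: poly_monom)
  have "bij ((*) g)"
    using g by (intro bij_betwI[where g = "\<lambda>y. y / g"]) auto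
  then have "(\<Sum>x\<in>UNIV. (g * x) ^ j) = (\<Sum>x\<in>UNIV. x ^ j)"
    by (rule sum.reindex_bij_betw)
  then have "g ^ j * (\<Sum>x\<in>UNIV. x ^ j) = 1 * (\<Sum>x\<in>UNIV. x ^ j)"
    by (simp add: power_mult_distrib flip: sum_distrib_left)
  with g show ?thesis
    by (metis mult_cancel_right)
qed

lemma sum_power_finite_field_add_card:
  fixes j :: nat
  assumes "j > 0"
  shows "(\<Sum>x\<in>UNIV. x ^ (j + (CARD('a) - 1))) = (\<Sum>x\<in>UNIV. (x :: 'a::{field,finite}) ^ j)"
proof (rule sum.cong)
  fix x :: 'a
  show "x ^ (j + (CARD('a) - 1)) = x ^ j"
  proof (cases "x = 0")
    case False
    then show ?thesis
      by (simp only: power_add finite_field_power_card_minus_1[OF False] mult_1_right)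
  next
    case True
    with assms show ?thesis
      by (simp only: power_add zero_power mult_zero_left)
  qed
qed simp

lemma sum_power_card_minus_1:
  "(\<Sum>x\<in>UNIV. x ^ (CARD('a) - 1)) = (-1 :: 'a::{field,finite})"
proof -
  let ?q = "CARD('a) - 1"
  have q: "CARD('a) \<ge> 2"
    using card_mono[of UNIV "{0, 1 :: 'a}"] by simp
  have "(\<Sum>x\<in>UNIV. (x :: 'a) ^ ?q) = (\<Sum>x\<in>UNIV - {0}. x ^ ?q)"
    using q by (intro sum.mono_neutral_right) auto
  also have "\<dots> = (\<Sum>x\<in>UNIV - {0 :: 'a}. 1)"
    by (intro sum.cong refl finite_field_power_card_minus_1) simp
  also have "\<dots> = of_nat (CARD('a) - 1)"
    by (simp add: card_Diff_subset)
  finally show ?thesis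
    using q by (simp add: of_nat_CARD_eq_0)
qed

text \<open>Positive exponents matter only modulo \<open>CARD('a) - 1\<close>, and exponent 0 sums
  to \<open>CARD('a) = 0\<close>. The bound leaves two contributing exponents; the second matters
  only for fields of order 17.\<close>

lemma sum_poly_finite_field:
  fixes p :: "'a::{field,finite} poly"
  assumes "degree p < 3 * (CARD('a) - 1)" and "CARD('a) > 2"
  shows "(\<Sum>x\<in>UNIV. poly p x) = - (coeff p (CARD('a) - 1) + coeff p (2 * (CARD('a) - 1)))"
proof -
  define r where "r = CARD('a) - 1"
  have r: "r > 1" using assms by (simp add: r_def)
  have S: "(\<Sum>x\<in>UNIV. (x :: 'a) ^ i) = (if i = r \<or> i = 2 * r then -1 else 0)" if "i < 3 * r" for i
  proof -
    consider "i < r" | "i = r" | "r < i" "i < 2 * r" | "i = 2 * r" | "2 * r < i"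
      by linarith
    then show ?thesis
    proof cases
      case 1
      then show ?thesis using sum_power_finite_field_eq_0[of i, where ?'a = 'a] unfolding r_def[symmetric] by simp
    next
      case 2
      then show ?thesis using sum_power_card_minus_1[where ?'a = 'a] unfolding r_def[symmetric] by simp
    next
      case 3
      then show ?thesis
        using sum_power_finite_field_add_card[of "i - r", where ?'a = 'a]
          sum_power_finite_field_eq_0[of "i - r", where ?'a = 'a] unfolding r_def[symmetric] by simp
    next
      case 4
      then show ?thesis
        using r sum_power_finite_field_add_card[of r, where ?'a = 'a]
          sum_power_card_minus_1[where ?'a = 'a]
        unfolding r_def[symmetric] by (simp add: mult_2)
    next
      case 5
      then show ?thesis
        using that sum_power_finite_field_add_card[of "i - r", where ?'a = 'a]
          sum_power_finite_field_add_card[of "i - 2 * r", where ?'a = 'a]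
          sum_power_finite_field_eq_0[of "i - 2 * r", where ?'a = 'a]
        unfolding r_def[symmetric] by simp
    qed
  qed
  have "(\<Sum>x\<in>UNIV. poly p x) = (\<Sum>x\<in>UNIV. \<Sum>i<3 * r. coeff p i * x ^ i)"
  proof (rule sum.cong)
    fix x
    show "poly p x = (\<Sum>i<3 * r. coeff p i * x ^ i)"
      unfolding poly_altdef using assms(1)
      by (intro sum.mono_neutral_left) (auto simp: r_def coeff_eq_0)
  qed simp
  also have "\<dots> = (\<Sum>i<3 * r. coeff p i * (\<Sum>x\<in>UNIV. x ^ i))"
    by (subst sum.swap) (simp add: sum_distrib_left)
  also have "\<dots> = (\<Sum>i<3 * r. if i = r \<or> i = 2 * r then - coeff p i else 0)"
    by (intro sum.cong) (auto simp: S)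
  also have "\<dots> = (\<Sum>i\<in>{r, 2 * r}. - coeff p i)"
    using r by (intro sum.mono_neutral_cong_right) auto
  also have "\<dots> = - (coeff p r + coeff p (2 * r))"
    using r by simp
  finally show ?thesis by (simp add: r_def)
qed

lemma sum_power_bij_finite_field:
  fixes F :: "'a::{field,finite} \<Rightarrow> 'a"
  assumes "bij F" and "k < CARD('a) - 1"
  shows "(\<Sum>x\<in>UNIV. F x ^ k) = 0"
  using sum.reindex_bij_betw[OF assms(1), of "\<lambda>y. y ^ k"] sum_power_finite_field_eq_0[OF assms(2)]
  by simp

section \<open>Coefficients of powers of a sextic\<close>

lemma degree_sextic_power:
  "degree (pCons 0 (monom 1 5 + [:d, c, b, a:] :: 'a::idom poly) ^ k) \<le> 6 * k"
proof -
  have "degree (monom 1 5 + [:d, c, b, a:] :: 'a poly) \<le> 5"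
    by (intro degree_add_le) (auto simp: degree_monom_le)
  then have "degree (pCons 0 (monom 1 5 + [:d, c, b, a:] :: 'a poly)) \<le> 6"
    by simp
  then show ?thesis
    by (metis degree_power_le le_trans mult_le_mono1)
qed

text \<open>Expand \<open>x^k (h + x^5)^k\<close> binomially: taking \<open>h\<close> exactly
  \<open>n\<close> times leaves degree \<open>N - (6k - 5n) = 5n - D\<close> to \<open>h^n\<close>.
  As \<open>h^n\<close> has degree at most \<open>e n\<close>, terms with \<open>n \<ge> M\<close>
  vanish, so the number of terms does not grow with \<open>k\<close>.\<close>

lemma coeff_sextic_power:
  fixes h :: "'a::comm_ring_1 poly"
  assumes "N + D = 6 * k" and "degree h \<le> e" and "D + e * M < 5 * M"
  shows "coeff (pCons 0 (monom 1 5 + h) ^ k) N =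
    (\<Sum>n<M. if D \<le> 5 * n then of_nat (k choose n) * coeff (h ^ n) (5 * n - D) else 0)"
proof -
  let ?T = "\<lambda>n. if D \<le> 5 * n then of_nat (k choose n) * coeff (h ^ n) (5 * n - D) else 0"
  have "pCons 0 (monom 1 5 + h) ^ k =
      (\<Sum>n\<le>k. smult (of_nat (k choose n)) (monom 1 (k + 5 * (k - n)) * h ^ n))"
  proof -
    have "pCons 0 (monom 1 5 + h) = monom 1 1 * (h + monom 1 5)"
      by (simp add: monom_Suc add.commute)
    then have "pCons 0 (monom 1 5 + h) ^ k = monom 1 k * (h + monom 1 5) ^ k"
      by (simp add: power_mult_distrib monom_power)
    also have "(h + monom 1 5) ^ k = (\<Sum>n\<le>k. of_nat (k choose n) * h ^ n * monom 1 (5 * (k - n)))"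
      by (simp add: binomial_ring monom_power)
    also have "monom 1 k * \<dots> =
        (\<Sum>n\<le>k. of_nat (k choose n) * (monom 1 k * monom 1 (5 * (k - n)) * h ^ n))"
      by (simp only: sum_distrib_left mult_ac)
    also have "\<dots> = (\<Sum>n\<le>k. smult (of_nat (k choose n)) (monom 1 (k + 5 * (k - n)) * h ^ n))"
      by (simp add: mult_monom of_nat_poly)
    finally show ?thesis .
  qed
  then have "coeff (pCons 0 (monom 1 5 + h) ^ k) N =
      (\<Sum>n\<le>k. of_nat (k choose n) * coeff (monom 1 (k + 5 * (k - n)) * h ^ n) N)"
    by (simp add: coeff_sum)
  also have "\<dots> = (\<Sum>n\<le>k. ?T n)"
  proof (intro sum.cong refl)
    fix n assume "n \<in> {..k}"
    then have "N < k + 5 * (k - n) \<longleftrightarrow> \<not> D \<le> 5 * n"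
        "D \<le> 5 * n \<Longrightarrow> N - (k + 5 * (k - n)) = 5 * n - D"
      using assms(1) by auto
    then show "of_nat (k choose n) * coeff (monom 1 (k + 5 * (k - n)) * h ^ n) N = ?T n"
      by (auto simp: coeff_monom_mult)
  qed
  also have "\<dots> = (\<Sum>n<k + M + 1. ?T n)"
    by (intro sum.mono_neutral_left) (auto simp: binomial_eq_0)
  also have "\<dots> = (\<Sum>n<M. ?T n)"
  proof (intro sum.mono_neutral_right ballI)
    fix n assume "n \<in> {..<k + M + 1} - {..<M}"
    then obtain i where i: "n = M + i"
      using le_Suc_ex by (auto simp: not_less)
    have "e < 5"
      using assms(3) mult_le_mono1[of 5 e M] by linarith
    then have "e * i \<le> 5 * i"
      by simp
    with assms(3) have "D + e * n < 5 * n"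
      unfolding i distrib_left by linarith
    moreover have "degree (h ^ n) \<le> e * n"
      using degree_power_le[of h n] mult_le_mono1[OF assms(2), of n] by linarith
    ultimately show "?T n = 0"
      by (simp add: coeff_eq_0)
  qed auto
  finally show ?thesis .
qed

text \<open>Absorption inside the ring: binomials of \<open>k\<close> become computable from the
  field value of \<open>k\<close> alone.\<close>

lemma of_nat_binomial_Suc:
  "of_nat (Suc n) * of_nat (k choose Suc n) = (of_nat k - of_nat n) * (of_nat (k choose n) :: 'a::comm_ring_1)"
proof (cases "n \<le> k")
  case True
  have "Suc n * (k choose Suc n) = (k - n) * (k choose n)"
    by (metis binomial_absorb_comp binomial_absorption)
  from arg_cong[OF this, of "of_nat :: nat \<Rightarrow> 'a"] True show ?thesis
    by (simp only: of_nat_mult of_nat_diff)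
qed (simp add: binomial_eq_0)


section \<open>Hermite's condition for sextics\<close>

lemma hermite_sextic:
  fixes a b c d :: "'a::{field,finite}"
  assumes bij: "bij (\<lambda>x. x ^ 6 + a * x ^ 4 + b * x ^ 3 + c * x ^ 2 + d * x)"
    and "0 < D" and "CARD('a) - 1 + D = 6 * k" and "6 * k < 3 * (CARD('a) - 1)"
  defines "P \<equiv> pCons 0 (monom 1 5 + [:d, c, b, a:])"
  shows "coeff (P ^ k) (CARD('a) - 1) + coeff (P ^ k) (2 * (CARD('a) - 1)) = 0"
proof -
  have P: "poly P x = x ^ 6 + a * x ^ 4 + b * x ^ 3 + c * x ^ 2 + d * x" for x
    by (simp add: P_def poly_monom algebra_simps power_numeral_reduce)
  have "(\<Sum>x\<in>UNIV. poly P x ^ k) = 0"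
    unfolding P using assms by (intro sum_power_bij_finite_field) auto
  moreover have "degree (P ^ k) < 3 * (CARD('a) - 1)"
    using degree_sextic_power[of d c b a k] assms unfolding P_def by linarith
  moreover have "CARD('a) > 2"
  proof -
    have "k > 0"
      using assms(2,3) by (cases k) auto
    with assms(4) show ?thesis
      by linarith
  qed
  ultimately show ?thesis
    using sum_poly_finite_field[of "P ^ k"] by (simp add: algebra_simps)
qed

lemma hermite_sextic_low:
  fixes a b c d :: "'a::{field,finite}"
  assumes "bij (\<lambda>x. x ^ 6 + a * x ^ 4 + b * x ^ 3 + c * x ^ 2 + d * x)"
    and "0 < D" and "CARD('a) - 1 + D = 6 * k" and "6 * k < 2 * (CARD('a) - 1)"
  shows "coeff (pCons 0 (monom 1 5 + [:d, c, b, a:]) ^ k) (CARD('a) - 1) = 0"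
proof -
  have "coeff (pCons 0 (monom 1 5 + [:d, c, b, a:]) ^ k) (2 * (CARD('a) - 1)) = 0"
    using degree_sextic_power[of d c b a k] assms(4) by (intro coeff_eq_0) linarith
  with hermite_sextic[OF assms(1-3)] assms(4) show ?thesis
    by simp
qed

section \<open>Explicit coefficients for small \<open>D\<close>\<close>

lemma coeff_sextic_power_2:
  fixes a b c d :: "'a::idom"
  assumes "N + 2 = 6 * k"
  shows "coeff (pCons 0 (monom 1 5 + [:d, c, b, a:]) ^ k) N = of_nat k * a"
  by (subst coeff_sextic_power[OF assms, of _ 3 2]) (auto simp: numeral_eq_Suc)

text \<open>Serves order 17 only, where \<open>2 * 16 = 6 * 6 - 4\<close>.\<close>

lemma coeff_sextic_power_4:
  fixes b c d :: "'a::idom"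
  assumes "N + 4 = 6 * k"
  shows "coeff (pCons 0 (monom 1 5 + [:d, c, b:]) ^ k) N = of_nat k * c"
  by (subst coeff_sextic_power[OF assms, of _ 2 2]) (auto simp: numeral_eq_Suc)

lemma coeff_sextic_power_8:
  fixes b c d :: "'a::idom"
  assumes "N + 8 = 6 * k"
  shows "coeff (pCons 0 (monom 1 5 + [:d, c, b:]) ^ k) N = of_nat (k choose 2) * (c ^ 2 + 2 * b * d)"
  by (subst coeff_sextic_power[OF assms, of _ 2 3])
    (auto simp: numeral_eq_Suc algebra_simps)

text \<open>Only \<open>n = 3\<close> and \<open>n = 4\<close> survive, through degrees 1 and 6 of
  \<open>h^n\<close>.\<close>

lemma coeff_sextic_power_14:
  fixes b c d :: "'a::idom"
  assumes "N + 14 = 6 * k"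
  shows "coeff (pCons 0 (monom 1 5 + [:d, c, b:]) ^ k) N =
    of_nat (k choose 3) * (3 * c * d ^ 2) + of_nat (k choose 4) * (4 * b ^ 3 * d + 6 * b ^ 2 * c ^ 2)"
proof -
  let ?h = "[:d, c, b:]"
  have h2: "?h ^ 2 = [:d ^ 2, 2 * c * d, c ^ 2 + 2 * b * d, 2 * b * c, b ^ 2:]"
    by (simp add: power2_eq_square algebra_simps)
  have "coeff (?h ^ 3) 1 = 3 * c * d ^ 2"
    unfolding power3_eq_cube mult.assoc power2_eq_square[symmetric] h2
    by (simp add: numeral_eq_Suc algebra_simps)
  moreover have "coeff ((?h ^ 2) ^ 2) 6 = 4 * b ^ 3 * d + 6 * b ^ 2 * c ^ 2"
    unfolding h2 by (simp add: numeral_eq_Suc algebra_simps)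
  ultimately show ?thesis
    by (subst coeff_sextic_power[OF assms, of _ 2 5])
      (auto simp: lessThan_nat_numeral lessThan_Suc simp flip: power_mult)
qed

text \<open>Only \<open>n = 4, 5, 6\<close> survive, through degrees 0, 5 and 10 of
  \<open>h^n\<close>.\<close>

lemma coeff_sextic_power_20:
  fixes b c d :: "'a::idom"
  assumes "N + 20 = 6 * k"
  shows "coeff (pCons 0 (monom 1 5 + [:d, c, b:]) ^ k) N =
    of_nat (k choose 4) * d ^ 4
    + of_nat (k choose 5) * (c ^ 5 + 20 * b * c ^ 3 * d + 30 * b ^ 2 * c * d ^ 2)
    + of_nat (k choose 6) * (6 * b ^ 5 * d + 15 * b ^ 4 * c ^ 2)"
proof -
  let ?h = "[:d, c, b:]"
  have h2: "?h ^ 2 = [:d ^ 2, 2 * c * d, c ^ 2 + 2 * b * d, 2 * b * c, b ^ 2:]"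
    by (simp add: power2_eq_square algebra_simps)
  have h3: "?h ^ 3 = [:d ^ 3, 3 * c * d ^ 2, 3 * c ^ 2 * d + 3 * b * d ^ 2, c ^ 3 + 6 * b * c * d,
      3 * b * c ^ 2 + 3 * b ^ 2 * d, 3 * b ^ 2 * c, b ^ 3:]"
    unfolding power3_eq_cube by (simp add: algebra_simps power2_eq_square)
  have "coeff (?h ^ 4) 0 = d ^ 4"
    by (simp add: coeff_0_power)
  moreover have "coeff (?h ^ 3 * ?h ^ 2) 5 = c ^ 5 + 20 * b * c ^ 3 * d + 30 * b ^ 2 * c * d ^ 2"
    unfolding h2 h3 by (simp add: numeral_eq_Suc algebra_simps)
  moreover have "coeff (?h ^ 3 * ?h ^ 3) 10 = 6 * b ^ 5 * d + 15 * b ^ 4 * c ^ 2"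
    unfolding h3 by (simp add: numeral_eq_Suc algebra_simps)
  ultimately show ?thesis
    by (subst coeff_sextic_power[OF assms, of _ 2 7])
      (auto simp: lessThan_nat_numeral lessThan_Suc simp flip: power_add)
qed

section \<open>The characteristic modulo 6\<close>

text \<open>A power of the characteristic is 5 modulo 6, so its residue is coprime to 6; residue 1
  would have only powers 1.\<close>

lemma CHAR_mod_6:
  assumes "primepow CARD('a::{field,finite})" and "CARD('a) mod 6 = 5"
  shows "prime CHAR('a)" "CHAR('a) mod 6 = 5"
proof -
  show p: "prime CHAR('a)"
    using prime_CHAR_semidom[where ?'a = 'a] finite_imp_CHAR_pos[where ?'a = 'a] by simp
  obtain e where e: "CARD('a) = CHAR('a) ^ e"
    using assms(1) p of_nat_CARD_eq_0[where ?'a = 'a]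
    unfolding of_nat_eq_0_iff_char_dvd by (metis primepow_def prime_dvd_power primes_dvd_imp_eq)
  define c where "c = CHAR('a) mod 6"
  have c: "c ^ e mod 6 = 5"
    using assms(2) by (simp add: c_def e power_mod)
  have "e \<noteq> 0"
    using e assms(2) by (cases e) auto
  have "\<not> 2 dvd c ^ e" "\<not> 3 dvd c ^ e"
    using c by presburger+
  then have "\<not> 2 dvd c" "\<not> 3 dvd c"
    using \<open>e \<noteq> 0\<close> by (meson dvd_power dvd_trans gr0I)+
  moreover have "c \<noteq> 1"
    using c by auto
  moreover have "c < 6"
    by (simp add: c_def)
  ultimately have "c = 5"
    by presburger
  then show "CHAR('a) mod 6 = 5"
    by (simp add: c_def)
qed

lemma numeral_prime_neq_0:
  assumes "primepow CARD('a::{field,finite})" and "CARD('a) mod 6 = 5"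
    and "prime (numeral r :: nat)" and "numeral r mod (6 :: nat) \<noteq> 5"
  shows "(numeral r :: 'a) \<noteq> 0"
proof
  assume "(numeral r :: 'a) = 0"
  then have "CHAR('a) dvd numeral r"
    by (metis of_nat_eq_0_iff_char_dvd of_nat_numeral)
  then have "CHAR('a) = numeral r"
    using CHAR_mod_6(1)[OF assms(1,2)] assms(3) primes_dvd_imp_eq by blast
  with CHAR_mod_6(2)[OF assms(1,2)] assms(4) show False
    by simp
qed

section \<open>Normalized sextics\<close>

lemma no_normalized_sextic_bijection:
  fixes a b c d :: "'a::{field,finite}"
  assumes pp: "primepow CARD('a)" and mod6: "CARD('a) mod 6 = 5" and gt: "CARD('a) > 11"
    and bij: "bij (\<lambda>x. x ^ 6 + a * x ^ 4 + b * x ^ 3 + c * x ^ 2 + d * x)"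
  shows False
proof -
  note nz = numeral_prime_neq_0[OF pp mod6]
  have nz2: "(2 :: 'a) \<noteq> 0" and nz3: "(3 :: 'a) \<noteq> 0" and nz7: "(7 :: 'a) \<noteq> 0"
    and nz13: "(13 :: 'a) \<noteq> 0" and nz19: "(19 :: 'a) \<noteq> 0" and nz313: "(313 :: 'a) \<noteq> 0"
    by (rule nz; simp)+
  obtain m where m: "CARD('a) = 6 * m + 5"
    using mod6 by (metis mult.commute div_mult_mod_eq)
  \<comment> \<open>This gives \<open>6 k < 2 (q - 1)\<close> for \<open>D \<le> 14\<close>; for
    \<open>D = 20\<close> one needs \<open>m \<ge> 3\<close>.\<close>
  then have m2: "m \<ge> 2"
    using gt by linarith
  have M: "6 * of_nat m + 5 = (0 :: 'a)"
    using of_nat_CARD_eq_0[where ?'a = 'a] by (simp add: m)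
  have q1: "CARD('a) - 1 = 6 * m + 4"
    by (simp add: m)
  have a: "a = 0"
  proof -
    have "of_nat (m + 1) * a = 0"
      using hermite_sextic_low[OF bij, of 2 "m + 1"] m2
        coeff_sextic_power_2[of "CARD('a) - 1" "m + 1" d c b a] unfolding q1 by simp
    moreover have "6 * of_nat (m + 1) = (1 :: 'a)"
      using M by (simp add: algebra_simps)
    ultimately show ?thesis
      by (metis mult_zero_right mult_eq_0_iff zero_neq_one)
  qed
  note low = hermite_sextic_low[OF bij, unfolded a q1]
  have Suc: "of_nat (Suc n) * of_nat (k choose Suc n)
      = (of_nat k - of_nat n) * (of_nat (k choose n) :: 'a)" for n k
    by (rule of_nat_binomial_Suc)
  have bin: "2 * of_nat (k choose 2) = (of_nat k - 1) * (of_nat k :: 'a)"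
    "3 * of_nat (k choose 3) = (of_nat k - 2) * (of_nat (k choose 2) :: 'a)"
    "4 * of_nat (k choose 4) = (of_nat k - 3) * (of_nat (k choose 3) :: 'a)"
    "5 * of_nat (k choose 5) = (of_nat k - 4) * (of_nat (k choose 4) :: 'a)"
    "6 * of_nat (k choose 6) = (of_nat k - 5) * (of_nat (k choose 5) :: 'a)" for k
    using Suc[of 1 k] Suc[of 2 k] Suc[of 3 k] Suc[of 4 k] Suc[of 5 k] by (simp_all add: numeral_eq_Suc)
  have E1: "c ^ 2 + 2 * b * d = 0"
  proof -
    let ?k = "m + 2"
    have "of_nat (?k choose 2) * (c ^ 2 + 2 * b * d) = 0"
      using low[of 8 ?k] m2 coeff_sextic_power_8[of "6 * m + 4" ?k d c b] by simp
    moreover have "6 * of_nat ?k = (7 :: 'a)"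
      using M by (simp add: algebra_simps)
    \<comment> \<open>\<open>36 k (k - 1) = 7 * 1\<close> because \<open>6 k = 7\<close>.\<close>
    with bin(1)[of ?k] have "72 * of_nat (?k choose 2) = (7 :: 'a)"
      by algebra
    ultimately show ?thesis
      using nz7 by (metis mult_zero_right mult_eq_0_iff)
  qed
  have E2: "d * (5 * b ^ 3 + 9 * c * d) = 0"
  proof -
    let ?k = "m + 3"
    let ?C3 = "of_nat (?k choose 3) :: 'a" and ?C4 = "of_nat (?k choose 4) :: 'a"
    have "?C3 * (3 * c * d ^ 2) + ?C4 * (4 * b ^ 3 * d + 6 * b ^ 2 * c ^ 2) = 0"
      using low[of 14 ?k] m2 coeff_sextic_power_14[of "6 * m + 4" ?k d c b] by simp
    moreover have K: "6 * of_nat ?k = (13 :: 'a)"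
      using M by (simp add: algebra_simps)
    moreover have C4: "24 * ?C4 = - 5 * ?C3"
      using bin(3)[of ?k] K by algebra
    \<comment> \<open>By \<open>E1\<close>, the factor of \<open>?C4\<close> is
      \<open>-8 b^3 d\<close>.\<close>
    ultimately have "4 * ?C3 * (d * (5 * b ^ 3 + 9 * c * d)) = 0"
      using E1 by algebra
    \<comment> \<open>\<open>1296 = 6 * 6^3\<close>, and \<open>6 k\<close>,
      \<open>6 (k - 1)\<close>, \<open>6 (k - 2)\<close> are 13, 7, 1.\<close>
    moreover have "1296 * ?C3 = 91"
      using bin(1,2)[of ?k] K by algebra
    then have "1296 * ?C3 = 7 * 13"
      by simp
    then have "?C3 \<noteq> 0"
      using nz7 nz13 by (metis mult_eq_0_iff mult_zero_right)
    moreover have "(4 :: 'a) \<noteq> 0"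
      using nz2 by (metis mult_eq_0_iff numeral_Bit0 mult_2)
    ultimately show ?thesis
      by simp
  qed
  let ?C4 = "of_nat (m + 4 choose 4) :: 'a" and ?C5 = "of_nat (m + 4 choose 5) :: 'a"
    and ?C6 = "of_nat (m + 4 choose 6) :: 'a"
  let ?S = "?C4 * d ^ 4 + ?C5 * (c ^ 5 + 20 * b * c ^ 3 * d + 30 * b ^ 2 * c * d ^ 2)
    + ?C6 * (6 * b ^ 5 * d + 15 * b ^ 4 * c ^ 2)"
  have K: "6 * of_nat (m + 4) = (19 :: 'a)"
    using M by (simp add: algebra_simps)
  \<comment> \<open>\<open>31104 = 24 * 6^4\<close> and
    \<open>1729 = 19 * 13 * 7 * 1\<close>.\<close>
  have "31104 * ?C4 = 1729"
    using bin(1-3)[of "m + 4"] K by algebra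
  then have "31104 * ?C4 = 7 * 13 * 19"
    by simp
  then have C4: "?C4 \<noteq> 0"
    using nz7 nz13 nz19 by (metis mult_eq_0_iff mult_zero_right)
  have d: "d \<noteq> 0"
  proof
    assume d: "d = 0"
    with E1 have c: "c = 0"
      by simp
    have F: "inj (\<lambda>x. x ^ 6 + b * x ^ 3)"
      using bij by (simp add: a c d bij_is_inj)
    \<comment> \<open>The map factors through cubing, so cubing is bijective and \<open>- b\<close>
      has a cube root, a zero of the map. Injectivity forces it to be 0, leaving \<open>x^6\<close>,
      which identifies 1 and \<open>-1\<close>.\<close>
    have "inj (\<lambda>x :: 'a. x ^ 3)"
    proof (rule injI)
      fix x y :: 'a
      assume "x ^ 3 = y ^ 3"
      then have "x ^ 6 + b * x ^ 3 = y ^ 6 + b * y ^ 3"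
        by algebra
      with F show "x = y"
        by (auto dest: injD)
    qed
    then have "surj (\<lambda>x :: 'a. x ^ 3)"
      by (simp add: finite_UNIV_inj_surj)
    then obtain y where y: "y ^ 3 = - b"
      by (metis surjD)
    then have "y ^ 6 + b * y ^ 3 = 0"
      by algebra
    then have "y = 0"
      using injD[OF F, of y 0] by simp
    with y have "b = 0"
      by simp
    with F have "inj (\<lambda>x :: 'a. x ^ 6)"
      by simp
    from injD[OF this, of 1 "- 1"] have "(1 :: 'a) = - 1"
      by simp
    with nz2 show False
      by (metis add.right_inverse one_add_one)
  qed
  with E2 have E2': "5 * b ^ 3 + 9 * c * d = 0"
    by simp
  have S: "?S \<noteq> 0" if "b = 0"
    using that E1 C4 d by simp
  \<comment> \<open>The residue modulo 6 does not exclude characteristic 5, yet the recurrence for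
    \<open>?C5\<close> divides by 5.\<close>
  have nz5: "(5 :: 'a) \<noteq> 0" if "b \<noteq> 0"
  proof
    assume "(5 :: 'a) = 0"
    with E2' have "9 * c * d = 0"
      by simp
    moreover have "(9 :: 'a) = 3 * 3"
      by simp
    with nz3 have "(9 :: 'a) \<noteq> 0"
      by (metis mult_eq_0_iff)
    ultimately have "c = 0"
      using d by simp
    with E1 nz2 d that show False
      by simp
  qed
  show False
  proof (cases "m = 2")
    case False
    then have "?S = 0"
      using low[of 20 "m + 4"] m2 coeff_sextic_power_20[of "6 * m + 4" "m + 4" d c b] by simp
    with S have b: "b \<noteq> 0"
      by blast
    \<comment> \<open>\<open>6 (k - 4) = 19 - 24 = -5\<close>; likewise
      \<open>6 (k - 5) = -11\<close> below.\<close>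
    have "5 * (6 * ?C5 + ?C4) = 0"
      using bin(4)[of "m + 4"] K by algebra
    then have C5: "6 * ?C5 = - ?C4"
      using nz5[OF b] by (metis mult_eq_0_iff eq_neg_iff_add_eq_0)
    have C6: "36 * ?C6 = - 11 * ?C5"
      using bin(5)[of "m + 4"] K by algebra
    \<comment> \<open>By \<open>E1\<close>, the factors of \<open>?C5\<close> and \<open>?C6\<close>
      are \<open>-6 b^2 c d^2\<close> and \<open>-24 b^5 d\<close>. The constant 24 is split into
      primes known to be nonzero.\<close>
    have "2 * (2 * (2 * (3 * (?C4 * (d * (9 * d ^ 3 + 9 * b ^ 2 * c * d - 11 * b ^ 5)))))) = 0"
      using \<open>?S = 0\<close> C5 C6 E1 by algebra
    then have "9 * d ^ 3 + 9 * b ^ 2 * c * d - 11 * b ^ 5 = 0"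
      using nz2 nz3 C4 d by (metis mult_eq_0_iff)
    then have 1: "9 * d ^ 3 = 16 * b ^ 5"
      using E2' by algebra
    \<comment> \<open>Square \<open>9 c d = -5 b^3\<close> and replace \<open>c^2\<close> by
      \<open>-2 b d\<close>.\<close>
    have "b * (25 * b ^ 5 + 162 * d ^ 3) = 0"
      using E1 E2' by algebra
    then have "25 * b ^ 5 + 162 * d ^ 3 = 0"
      using b by simp
    \<comment> \<open>\<open>162 d^3 = 18 * 16 b^5\<close>, and
      \<open>25 + 288 = 313\<close>.\<close>
    with 1 have "313 * b ^ 5 = 0"
      by algebra
    with nz313 b show False
      by simp
  next
    case True
    then have q: "CARD('a) - 1 = 16" and "(17 :: 'a) = 0"
      using m M by simp_all
    then have p17: "17 * x = 0" for x :: 'a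
      by simp
    \<comment> \<open>Here \<open>k = 6\<close>, and degree 36 exceeds \<open>2 * 16 = 32\<close>,
      where the coefficient is \<open>6 c\<close>.\<close>
    have S17: "?S + 6 * c = 0"
      using hermite_sextic[OF bij, of 20 6, unfolded a q]
        coeff_sextic_power_20[of 16 6 d c b] coeff_sextic_power_4[of 32 6 d c b] True by simp
    with S E1 have b: "b \<noteq> 0"
      by auto
    have "c \<noteq> 0"
      using E1 b d nz2 by auto
    \<comment> \<open>The coefficients \<open>b, c, d\<close> have weights 3, 4, 5 under \<open>x \<mapsto> s x\<close>, so all are multiples of powers of \<open>s\<close>.\<close>
    define s where "s = c / b"
    have s: "s \<noteq> 0" and c: "c = s * b"
      using b \<open>c \<noteq> 0\<close> by (simp_all add: s_def)
    have "b ^ 3 * (10 * b - 9 * s ^ 3) = 0"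
      using E1 E2' c by algebra
    then have "10 * b = 9 * s ^ 3"
      using b by simp
    \<comment> \<open>Multiply by 12, the inverse of 10 modulo 17.\<close>
    then have "b + 17 * (7 * b) = 6 * s ^ 3 + 17 * (6 * s ^ 3)"
      by algebra
    then have b6: "b = 6 * s ^ 3"
      unfolding p17 by simp
    have "b * (s ^ 2 * b + 2 * d) = 0"
      using E1 c by algebra
    then have "s ^ 2 * b + 2 * d = 0"
      using b by simp
    \<comment> \<open>Multiply by 9, the inverse of 2 modulo 17.\<close>
    then have "d + 17 * d = 14 * s ^ 5 - 17 * (4 * s ^ 5)"
      using b6 by algebra
    then have d14: "d = 14 * s ^ 5"
      unfolding p17 by simp
    have c6: "c = 6 * s ^ 4"
      using c b6 by algebra
    have s16: "s ^ 16 = 1"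
      using finite_field_power_card_minus_1[OF s] q by simp
    have "15 * d ^ 4 + 6 * (c ^ 5 + 20 * b * c ^ 3 * d + 30 * b ^ 2 * c * d ^ 2)
      + (6 * b ^ 5 * d + 15 * b ^ 4 * c ^ 2) + 6 * c = 0"
      using S17 True by (simp add: numeral_eq_Suc)
    \<comment> \<open>All of \<open>?S\<close> has weight 20, so it is a multiple of
      \<open>s^20 = s^4\<close>. Then \<open>11773680 + 36 = 9 + 17 * 692571\<close>.\<close>
    then have "11773680 * (s ^ 4 * s ^ 16) + 36 * s ^ 4 = 0"
      unfolding b6 d14 c6 by (simp add: power_mult_distrib flip: power_mult power_add)
    then have "9 * s ^ 4 + 17 * (692571 * s ^ 4) = 0"
      unfolding s16 by simp
    then have "3 * (3 * s ^ 4) = 0"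
      unfolding p17 by simp
    then show False
      using s nz3 by (metis mult_eq_0_iff power_eq_0_iff)
  qed
qed

section \<open>Reduction to normalized sextics\<close>

theorem theorem3p8:
  fixes q :: nat and m :: int
  assumes "primepow q"
    and "int q = 6 * m + 5"
    and "q > 11"
    and "CARD('a::{field,finite}) = q"
  shows "\<not> (\<exists>f :: 'a poly. permutation_poly f \<and> degree f = 6)"
proof
  assume "\<exists>f :: 'a poly. permutation_poly f \<and> degree f = 6"
  then obtain f :: "'a poly" where f: "bij (poly f)" "degree f = 6"
    by (auto simp: permutation_poly_def)
  have mod6: "CARD('a) mod 6 = 5"
    using assms(2,4) by presburger
  have pp: "primepow CARD('a)"
    using assms by simp
  have nz2: "(2 :: 'a) \<noteq> 0" and nz3: "(3 :: 'a) \<noteq> 0"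
    by (rule numeral_prime_neq_0[OF pp mod6]; simp)+
  have "(6 :: 'a) = 2 * 3"
    by simp
  with nz2 nz3 have nz6: "(6 :: 'a) \<noteq> 0"
    by (metis mult_eq_0_iff)
  define u where "u = coeff f 6"
  have u: "u \<noteq> 0"
    using f(2) leading_coeff_0_iff[of f] by (auto simp: u_def)
  define v where "v i = coeff f i / u" for i
  have poly_f: "poly f x = u * (x ^ 6 + v 5 * x ^ 5 + v 4 * x ^ 4 + v 3 * x ^ 3
      + v 2 * x ^ 2 + v 1 * x + v 0)" for x
    using u by (simp add: poly_altdef f(2) v_def u_def numeral_eq_Suc algebra_simps)
  \<comment> \<open>The shift that kills the \<open>x^5\<close> term, whose coefficient in
    \<open>f (x + t) / u\<close> is \<open>6 t + v 5\<close>.\<close>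
  define t where "t = - v 5 / 6"
  have t: "v 5 = - 6 * t"
    using nz6 by (simp add: t_def)
  obtain a b c d e where shift: "\<And>x. poly f (x + t) = u * (x ^ 6 + a * x ^ 4 + b * x ^ 3 + c * x ^ 2 + d * x) + e"
  proof
    fix x
    \<comment> \<open>The witnesses are the Taylor coefficients of \<open>f / u\<close> at
      \<open>t\<close>.\<close>
    show "poly f (x + t) = u * (x ^ 6 + (15 * t ^ 2 + 5 * t * v 5 + v 4) * x ^ 4
      + (20 * t ^ 3 + 10 * t ^ 2 * v 5 + 4 * t * v 4 + v 3) * x ^ 3
      + (15 * t ^ 4 + 10 * t ^ 3 * v 5 + 6 * t ^ 2 * v 4 + 3 * t * v 3 + v 2) * x ^ 2
      + (6 * t ^ 5 + 5 * t ^ 4 * v 5 + 4 * t ^ 3 * v 4 + 3 * t ^ 2 * v 3 + 2 * t * v 2 + v 1) * x)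
      + u * (t ^ 6 + t ^ 5 * v 5 + t ^ 4 * v 4 + t ^ 3 * v 3 + t ^ 2 * v 2 + t * v 1 + v 0)"
      unfolding poly_f t by algebra
  qed
  let ?F = "\<lambda>x. x ^ 6 + a * x ^ 4 + b * x ^ 3 + c * x ^ 2 + d * x"
  have "inj ?F"
  proof (rule injI)
    fix x y
    assume "?F x = ?F y"
    then have "poly f (x + t) = poly f (y + t)"
      by (simp add: shift)
    then have "x + t = y + t"
      by (rule injD[OF bij_is_inj[OF f(1)]])
    then show "x = y"
      by simp
  qed
  then have "bij ?F"
    by (simp add: bij_def finite_UNIV_inj_surj)
  with no_normalized_sextic_bijection[OF pp mod6] assms show False
    by simp
qed

end
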